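(* Let $t$ be a non-negative integer, let $H$ be a $t$-tree, let $P$ be a path, and let $G$ be a subgraph of the strong product $H\boxtimes P$. Then $G$ has a proper odd colouring that uses at most $8t+4$ colours.
   Context: All graphs are finite and simple. A $t$-tree is a graph that is either a clique on $t+1$ vertices, or a graph $H$ containing a vertex $v$ of degree $t$ whose neighbours form a clique and such that $H-\{v\}$ is a $t$-tree. For graphs $A$ and $B$, the strong product $A\boxtimes B$ has vertex set $V(A)\times V(B)$, and $(x_1,y_1)(x_2,y_2)$ is an edge iff (i) $x_1x_2\in E(A)$ and $y_1=y_2$, or (ii) $x_1=x_2$ and $y_1y_2\in E(B)$, or (iii) $x_1x_2\in E(A)$ and $y_1y_2\in E(B)$. A vertex colouring $\varphi:V(G)\to\mathbb{N}$ (not necessarily proper) is odd if for every vertex $v$ with $|N_G(v)|>0$ there is a colour $\alpha$ such that $|\{w\in N_G(v):\varphi(w)=\alpha\}|$ is odd. It is proper if $vw\in E(G)$ implies $\varphi(v)\neq\varphi(w)$. A colouring uses $c$ colours if $|\{\varphi(v):v\in V(G)\}|=c$. *)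

theory Defs
  imports "Graph_Theory.Graph_Theory"
begin

text \<open>
  Finite simple graphs are the \<^locale>\<open>pair_graph\<close>s: finite, loop-free digraphs whose
  arc relation is symmetric, so an edge \<open>uv\<close> is the pair of arcs \<open>(u, v)\<close>, \<open>(v, u)\<close>.
\<close>

definition neighbourhood :: "'a pair_pre_digraph \<Rightarrow> 'a \<Rightarrow> 'a set" where
  "neighbourhood G v = {w. (v, w) \<in> parcs G}"

definition forms_clique :: "'a pair_pre_digraph \<Rightarrow> 'a set \<Rightarrow> bool" where
  "forms_clique G S \<longleftrightarrow> S \<subseteq> pverts G \<and> (\<forall>x\<in>S. \<forall>y\<in>S. x \<noteq> y \<longrightarrow> (x, y) \<in> parcs G)"

definition delete_vertex :: "'a pair_pre_digraph \<Rightarrow> 'a \<Rightarrow> 'a pair_pre_digraph" where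
  "delete_vertex G v =
    \<lparr>pverts = pverts G - {v}, parcs = {(x, y) \<in> parcs G. x \<noteq> v \<and> y \<noteq> v}\<rparr>"

inductive t_tree :: "nat \<Rightarrow> 'a pair_pre_digraph \<Rightarrow> bool" for t :: nat where
  clique: "K\<^bsub>t + 1\<^esub> (with_proj H) \<Longrightarrow> t_tree t H"
| extend: "\<lbrakk>pair_graph H; v \<in> pverts H; card (neighbourhood H v) = t;
    forms_clique H (neighbourhood H v); t_tree t (delete_vertex H v)\<rbrakk> \<Longrightarrow> t_tree t H"

definition path_graph :: "'a pair_pre_digraph \<Rightarrow> bool" where
  "path_graph P \<longleftrightarrow> (\<exists>xs. xs \<noteq> [] \<and> distinct xs \<and> pverts P = set xs \<and>
    parcs P = {(xs ! i, xs ! j) | i j.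
      i < length xs \<and> j < length xs \<and> (j = Suc i \<or> i = Suc j)})"

definition strong_product ::
  "'a pair_pre_digraph \<Rightarrow> 'b pair_pre_digraph \<Rightarrow> ('a \<times> 'b) pair_pre_digraph"
  (infixl \<open>\<boxtimes>\<close> 70) where
  "A \<boxtimes> B = \<lparr>pverts = pverts A \<times> pverts B,
    parcs = {((x1, y1), (x2, y2)) | x1 y1 x2 y2.
      (x1, y1) \<in> pverts A \<times> pverts B \<and> (x2, y2) \<in> pverts A \<times> pverts B \<and>
      ((x1, x2) \<in> parcs A \<and> y1 = y2 \<or>
       x1 = x2 \<and> (y1, y2) \<in> parcs B \<or>
       (x1, x2) \<in> parcs A \<and> (y1, y2) \<in> parcs B)}\<rparr>"

definition proper_colouring :: "'a pair_pre_digraph \<Rightarrow> ('a \<Rightarrow> nat) \<Rightarrow> bool" where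
  "proper_colouring G \<phi> \<longleftrightarrow> (\<forall>(v, w) \<in> parcs G. \<phi> v \<noteq> \<phi> w)"

definition odd_colouring :: "'a pair_pre_digraph \<Rightarrow> ('a \<Rightarrow> nat) \<Rightarrow> bool" where
  "odd_colouring G \<phi> \<longleftrightarrow> (\<forall>v \<in> pverts G. card (neighbourhood G v) > 0 \<longrightarrow>
    (\<exists>\<alpha>. odd (card {w \<in> neighbourhood G v. \<phi> w = \<alpha>})))"

definition num_colours :: "'a pair_pre_digraph \<Rightarrow> ('a \<Rightarrow> nat) \<Rightarrow> nat" where
  "num_colours G \<phi> = card {\<phi> v | v. v \<in> pverts G}"

end

theory Submission
  imports Defs
begin

text \<open>
  Order the columns \<open>V(H)\<close> by an elimination order of the \<open>t\<close>-tree and the vertices of \<open>H \<boxtimes> P\<close>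
  lexicographically, by column and then by layer. Colour \<open>G\<close> greedily in this order; the vertex
  \<open>w = (y, j)\<close> has to avoid the colours of
  \<^item> the earlier vertices, at distance at most two in layers, in column \<open>y\<close> or in one of the at
    most \<open>t\<close> earlier neighbouring columns of \<open>y\<close> (at most \<open>5t + 2\<close> vertices);
  \<^item> the first \<open>G\<close>-neighbour of each vertex \<open>u\<close>, at distance at most one in layers, in one of the
    earlier neighbouring columns of \<open>y\<close> (at most \<open>3t\<close> vertices).

  So \<open>8t + 3\<close> colours suffice. The colouring is proper, and the colour of the first neighbour
  \<open>w\<^sub>0\<close> of any vertex \<open>u\<close> occurs exactly once around \<open>u\<close>: another neighbour \<open>w\<close> avoids it by the
  second rule if the column of \<open>u\<close> precedes that of \<open>w\<close>, and by the first rule otherwise, since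
  then the columns of \<open>w\<^sub>0\<close> and \<open>w\<close> lie in a common clique.
\<close>

section \<open>Elimination orders of \<open>t\<close>-trees\<close>

definition earlier_neighbours :: "'a pair_pre_digraph \<Rightarrow> ('a \<Rightarrow> nat) \<Rightarrow> 'a \<Rightarrow> 'a set" where
  "earlier_neighbours H r y = {x. (y, x) \<in> parcs H \<and> r x < r y}"

text \<open>Read backwards, the order by \<open>r\<close> is a perfect elimination ordering in which
  each vertex, when removed, has at most \<open>t\<close> remaining neighbours.\<close>

definition elimination_rank :: "nat \<Rightarrow> 'a pair_pre_digraph \<Rightarrow> ('a \<Rightarrow> nat) \<Rightarrow> bool" where
  "elimination_rank t H r \<longleftrightarrow> inj_on r (pverts H) \<and>
    (\<forall>y\<in>pverts H. card (earlier_neighbours H r y) \<le> t \<and> forms_clique H (earlier_neighbours H r y))"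

lemma pair_graph_arc_verts:
  assumes "pair_graph G" "(u, v) \<in> parcs G"
  shows "u \<in> pverts G" "v \<in> pverts G" "u \<noteq> v" "(v, u) \<in> parcs G"
proof -
  interpret pair_graph G by fact
  show "u \<in> pverts G" "v \<in> pverts G"
    using assms(2) by (auto dest: in_arcsD1 in_arcsD2)
  show "u \<noteq> v"
    using assms(2) pair_no_loops by fastforce
  show "(v, u) \<in> parcs G"
    using assms(2) pair_sym_arcs by (auto simp: symmetric_def sym_def)
qed

lemma pair_graph_finite_verts: "pair_graph G \<Longrightarrow> finite (pverts G)"
  by (simp add: pair_graph_def pair_digraph_def pair_fin_digraph_def pair_fin_digraph_axioms_def)

lemma t_tree_pair_graph:
  assumes "t_tree t H"
  shows "pair_graph H"
  using assms
proof cases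
  case clique
  then have H: "finite (pverts H)"
      "parcs H = {(u, v). (u, v) \<in> pverts H \<times> pverts H \<and> u \<noteq> v}"
    by (simp_all add: complete_digraph_pair_def)
  then have "finite (parcs H)"
    by (auto intro: finite_subset[of _ "pverts H \<times> pverts H"])
  with H show ?thesis
    by unfold_locales (auto simp: symmetric_def split: prod.splits intro: symI)
next
  case extend
  then show ?thesis by blast
qed

text \<open>In a clique on \<open>t + 1\<close> vertices any injective ranking works. For an
  extension the new vertex \<open>v\<close> is ranked last: its earlier neighbours are then its
  whole neighbourhood, a clique of size \<open>t\<close>, and it is no earlier neighbour of any
  other vertex.\<close>

lemma t_tree_elimination_rank:
  assumes "t_tree t H"
  shows "\<exists>r. elimination_rank t H r"
  using assms
proof induction
  case (clique H)
  then have H: "finite (pverts H)" "card (pverts H) = t + 1"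
      "parcs H = {(u, v). (u, v) \<in> pverts H \<times> pverts H \<and> u \<noteq> v}"
    by (simp_all add: complete_digraph_pair_def)
  obtain r :: "'a \<Rightarrow> nat" where r: "inj_on r (pverts H)"
    using finite_imp_inj_to_nat_seg[OF H(1)] by blast
  have "card (earlier_neighbours H r y) \<le> t" if "y \<in> pverts H" for y
  proof -
    have "card (earlier_neighbours H r y) \<le> card (pverts H - {y})"
      using H by (intro card_mono) (auto simp: earlier_neighbours_def)
    with H that show ?thesis by simp
  qed
  moreover have "forms_clique H (earlier_neighbours H r y)" for y
    using H(3) by (auto simp: forms_clique_def earlier_neighbours_def)
  ultimately show ?case
    using r by (auto simp: elimination_rank_def)
next
  case (extend H v)
  let ?H' = "delete_vertex H v"
  from extend.IH obtain r where r: "elimination_rank t ?H' r" by blast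
  have fin: "finite (pverts H)"
    using extend.hyps(1) by (rule pair_graph_finite_verts)
  \<comment> \<open>The maximum also ranges over the meaningless value \<open>r v\<close>, which is
    harmless: any bound above the other ranks will do.\<close>
  define m where "m = Suc (Max (r ` pverts H))"
  have m: "r x < m" if "x \<in> pverts H" for x
    using fin that by (simp add: m_def less_Suc_eq_le)
  define r' where "r' = r(v := m)"
  have v: "earlier_neighbours H r' v = neighbourhood H v"
    using m pair_graph_arc_verts(2,3)[OF extend.hyps(1)]
    by (fastforce simp: earlier_neighbours_def neighbourhood_def r'_def)
  have other: "earlier_neighbours H r' y = earlier_neighbours ?H' r y"
    if "y \<in> pverts H" "y \<noteq> v" for y
    using m[OF that(1)] that by (auto simp: earlier_neighbours_def delete_vertex_def r'_def)
  have clique_mono: "forms_clique H S" if "forms_clique ?H' S" for S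
    using that by (auto simp: forms_clique_def delete_vertex_def)
  have "inj_on r' (pverts H)"
    using r m unfolding elimination_rank_def delete_vertex_def r'_def inj_on_def
    by (auto split: if_splits)
  moreover have "card (earlier_neighbours H r' y) \<le> t \<and> forms_clique H (earlier_neighbours H r' y)"
    if "y \<in> pverts H" for y
  proof (cases "y = v")
    case True
    then show ?thesis using v extend.hyps by simp
  next
    case False
    with that have "y \<in> pverts ?H'" by (simp add: delete_vertex_def)
    with r other[OF that False] clique_mono show ?thesis
      by (simp add: elimination_rank_def)
  qed
  ultimately show ?case
    by (auto simp: elimination_rank_def)
qed

text \<open>The layers are the positions along the path. Their strict bound \<open>n\<close> later
  serves as the multiplier in a lexicographic rank.\<close>

lemma path_graph_layers:
  assumes "path_graph P"
  obtains l :: "'a \<Rightarrow> nat" and n where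
    "inj_on l (pverts P)" "\<And>p. p \<in> pverts P \<Longrightarrow> l p < n"
    "\<And>p q. (p, q) \<in> parcs P \<Longrightarrow> l q = Suc (l p) \<or> l p = Suc (l q)"
proof -
  from assms obtain xs where xs: "distinct xs" "pverts P = set xs"
    "parcs P = {(xs ! i, xs ! j) | i j.
      i < length xs \<and> j < length xs \<and> (j = Suc i \<or> i = Suc j)}"
    unfolding path_graph_def by blast
  define l where "l = the_inv_into {..<length xs} ((!) xs)"
  have inj: "inj_on ((!) xs) {..<length xs}"
    using xs(1) by (simp add: inj_on_nth)
  have l_nth: "l (xs ! i) = i" if "i < length xs" for i
    unfolding l_def using inj that by (simp add: the_inv_into_f_f)
  show ?thesis
  proof (rule that[of l "length xs"])
    show "inj_on l (pverts P)"
      unfolding xs(2) by (rule inj_onI) (metis in_set_conv_nth l_nth)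
  qed (auto simp: xs in_set_conv_nth l_nth)
qed

section \<open>Greedy colouring and a criterion for odd colourings\<close>

lemma greedy_colouring:
  fixes rank :: "'a \<Rightarrow> nat" and avoid :: "'a \<Rightarrow> 'a set"
  assumes "finite V"
    and fin: "\<And>v. v \<in> V \<Longrightarrow> finite (avoid v)"
    and card: "\<And>v. v \<in> V \<Longrightarrow> card (avoid v) \<le> k"
    and smaller: "\<And>v u. v \<in> V \<Longrightarrow> u \<in> avoid v \<Longrightarrow> rank u < rank v"
  obtains \<phi> :: "'a \<Rightarrow> nat" where "\<And>v. v \<in> V \<Longrightarrow> \<phi> v \<le> k"
    and "\<And>v u. v \<in> V \<Longrightarrow> u \<in> avoid v \<Longrightarrow> \<phi> u \<noteq> \<phi> v"
proof -
  \<comment> \<open>Induction on a bound for the ranks: at most \<open>k\<close> forbidden vertices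
    leave free one of the \<open>k + 1\<close> colours up to \<open>k\<close>. All vertices of rank
    \<open>n\<close> can be coloured at once, since their forbidden vertices have smaller
    rank.\<close>
  have "\<exists>\<phi> :: 'a \<Rightarrow> nat. \<forall>v\<in>V. rank v < n \<longrightarrow> \<phi> v \<le> k \<and> (\<forall>u\<in>avoid v. \<phi> u \<noteq> \<phi> v)" for n
  proof (induction n)
    case (Suc n)
    then obtain \<phi> :: "'a \<Rightarrow> nat" where
      \<phi>: "\<forall>v\<in>V. rank v < n \<longrightarrow> \<phi> v \<le> k \<and> (\<forall>u\<in>avoid v. \<phi> u \<noteq> \<phi> v)" by blast
    have "\<exists>c\<le>k. c \<notin> \<phi> ` avoid v" if "v \<in> V" for v
    proof (rule ccontr)
      assume "\<not> ?thesis"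
      then have "{..k} \<subseteq> \<phi> ` avoid v" by auto
      then have "card {..k} \<le> card (\<phi> ` avoid v)"
        using fin[OF that] by (intro card_mono) auto
      also have "\<dots> \<le> k"
        using card_image_le[OF fin[OF that]] card[OF that] by (rule order_trans)
      finally show False by simp
    qed
    then obtain c where c: "\<And>v. v \<in> V \<Longrightarrow> c v \<le> k \<and> c v \<notin> \<phi> ` avoid v" by metis
    define \<psi> where "\<psi> v = (if rank v = n then c v else \<phi> v)" for v
    have "\<psi> v \<le> k \<and> (\<forall>u\<in>avoid v. \<psi> u \<noteq> \<psi> v)" if "v \<in> V" "rank v < Suc n" for v
    proof -
      have "\<psi> u = \<phi> u" if "u \<in> avoid v" for u
        using smaller[OF \<open>v \<in> V\<close> that] \<open>rank v < Suc n\<close> by (simp add: \<psi>_def)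
      moreover have "\<psi> v \<le> k \<and> (\<forall>u\<in>avoid v. \<phi> u \<noteq> \<psi> v)"
        using \<phi> c[OF that(1)] that by (cases "rank v = n") (force simp: \<psi>_def)+
      ultimately show ?thesis by simp
    qed
    then show ?case by blast
  qed simp
  then obtain \<phi> :: "'a \<Rightarrow> nat" where
    "\<forall>v\<in>V. rank v < Suc (Max (rank ` V)) \<longrightarrow> \<phi> v \<le> k \<and> (\<forall>u\<in>avoid v. \<phi> u \<noteq> \<phi> v)"
    by blast
  moreover have "rank v < Suc (Max (rank ` V))" if "v \<in> V" for v
    using assms(1) that by (simp add: less_Suc_eq_le)
  ultimately show ?thesis using that by blast
qed

lemma odd_colouring_if_unique_colour:
  assumes "\<And>v. v \<in> pverts G \<Longrightarrow> neighbourhood G v \<noteq> {} \<Longrightarrow>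
    \<exists>w\<in>neighbourhood G v. \<forall>w'\<in>neighbourhood G v. \<phi> w' = \<phi> w \<longrightarrow> w' = w"
  shows "odd_colouring G \<phi>"
  unfolding odd_colouring_def
proof (intro ballI impI)
  fix v assume "v \<in> pverts G" "card (neighbourhood G v) > 0"
  then obtain w where w: "w \<in> neighbourhood G v"
      "\<forall>w'\<in>neighbourhood G v. \<phi> w' = \<phi> w \<longrightarrow> w' = w"
    using assms by force
  then have "{w' \<in> neighbourhood G v. \<phi> w' = \<phi> w} = {w}" by auto
  then have "odd (card {w' \<in> neighbourhood G v. \<phi> w' = \<phi> w})" by simp
  then show "\<exists>\<alpha>. odd (card {w \<in> neighbourhood G v. \<phi> w = \<alpha>})" by blast
qed

section \<open>Colouring subgraphs of the strong product\<close>

theorem theorem1: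
  fixes t :: nat
    and H :: "'a pair_pre_digraph"
    and P :: "'b pair_pre_digraph"
    and G :: "('a \<times> 'b) pair_pre_digraph"
  assumes "t_tree t H"
    and "path_graph P"
    and "pair_graph G"
    and "subgraph (with_proj G) (with_proj (H \<boxtimes> P))"
  shows "\<exists>\<phi>. proper_colouring G \<phi> \<and> odd_colouring G \<phi> \<and> num_colours G \<phi> \<le> 8 * t + 4"
proof -
  note H_arc = pair_graph_arc_verts[OF t_tree_pair_graph[OF assms(1)]]
  note G_arc = pair_graph_arc_verts[OF assms(3)]
  have finG: "finite (pverts G)"
    using assms(3) by (rule pair_graph_finite_verts)
  have finH: "finite (pverts H)"
    using t_tree_pair_graph[OF assms(1)] by (rule pair_graph_finite_verts)
  have finP: "finite (pverts P)"
    using assms(2) by (auto simp: path_graph_def)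
  obtain r where r: "elimination_rank t H r"
    using t_tree_elimination_rank[OF assms(1)] by blast
  then have r_inj: "inj_on r (pverts H)"
    by (simp add: elimination_rank_def)
  obtain l n where l_inj: "inj_on l (pverts P)" and l_less: "\<And>p. p \<in> pverts P \<Longrightarrow> l p < n"
    and l_arc: "\<And>p q. (p, q) \<in> parcs P \<Longrightarrow> l q = Suc (l p) \<or> l p = Suc (l q)"
    using path_graph_layers[OF assms(2)] by blast

  have G_vert: "y \<in> pverts H \<and> p \<in> pverts P" if "(y, p) \<in> pverts G" for y p
    using assms(4) that by (auto simp: subgraph_def strong_product_def)
  have G_prod: "(x = y \<or> (x, y) \<in> parcs H) \<and> l p \<le> l q + 1 \<and> l q \<le> l p + 1"
    if "((x, p), (y, q)) \<in> parcs G" for x y p q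
  proof -
    have "((x, p), (y, q)) \<in> parcs (H \<boxtimes> P)"
      using assms(4) that by (auto simp: subgraph_def)
    then show ?thesis
      using l_arc[of p q] by (auto simp: strong_product_def)
  qed

  define rank where "rank w = r (fst w) * n + l (snd w)" for w
  \<comment> \<open>Since \<open>l\<close> stays below \<open>n\<close> on the path,
    \<open>rank\<close> is lexicographic: column first, then layer.\<close>
  have rank_mono: "rank (x, p) < rank (y, q)" if "r x < r y" "p \<in> pverts P" for x y p q
  proof -
    have "r x * n + l p < Suc (r x) * n"
      using l_less[OF that(2)] by simp
    also have "\<dots> \<le> r y * n"
      using that(1) by (intro mult_le_mono1) simp
    finally show ?thesis by (simp add: rank_def)
  qed
  have rank_le: "r x \<le> r y" if "rank (x, p) \<le> rank (y, q)" "q \<in> pverts P" for x y p q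
    using rank_mono[of y x q p] that by linarith
  have rank_inj: "inj_on rank (pverts G)"
  proof (rule inj_onI, clarify)
    fix x p y q
    assume *: "(x, p) \<in> pverts G" "(y, q) \<in> pverts G" "rank (x, p) = rank (y, q)"
    then have "r x = r y"
      using rank_le[of x p y q] rank_le[of y q x p] G_vert by (simp add: order_antisym)
    with * have "l p = l q" by (simp add: rank_def)
    with \<open>r x = r y\<close> show "x = y \<and> p = q"
      using r_inj l_inj *(1,2) G_vert by (auto dest: inj_onD)
  qed

  define B where "B = earlier_neighbours H r"
  have finB: "finite (B y)" for y
    unfolding B_def earlier_neighbours_def
    by (rule finite_subset[OF _ finH]) (auto dest: H_arc)
  have cardB: "card (B y) \<le> t" if "y \<in> pverts H" for y
    using r that by (simp add: B_def elimination_rank_def)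
  have B_clique: "(x, y) \<in> parcs H" if "x \<in> B z" "y \<in> B z" "x \<noteq> y" "z \<in> pverts H" for x y z
    using r that by (auto simp: B_def elimination_rank_def forms_clique_def)
  have B_iff: "x \<in> B y \<longleftrightarrow> (y, x) \<in> parcs H \<and> r x < r y" for x y
    by (simp add: B_def earlier_neighbours_def)
  have B_cases: "x \<in> B y \<or> y \<in> B x" if "(x, y) \<in> parcs H" for x y
  proof -
    have "r x \<noteq> r y"
      using r_inj H_arc[OF that] by (auto dest: inj_onD)
    then show ?thesis
      using that H_arc(4)[OF that] by (auto simp: B_iff)
  qed

  \<comment> \<open>If \<open>u\<close> has no neighbour in \<open>G\<close>, then
    \<open>first u\<close> is unspecified. This does no harm: it can only add a forbidden vertex,
    and \<open>A3\<close> is bounded by counting the \<open>u\<close>, not their images.\<close>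
  define first where "first u = arg_min rank (\<lambda>w. w \<in> neighbourhood G u)" for u
  define layers where "layers I = {p \<in> pverts P. l p \<in> I}" for I
  have fin_layers: "finite (layers I)" for I
    using finP by (simp add: layers_def)
  have card_layers: "card (layers I) \<le> card I" if "finite I" for I
    using l_inj that by (intro card_inj_on_le[of l]) (auto simp: layers_def inj_on_def)

  \<comment> \<open>Within a column earlier means lower, so two layers suffice here instead of five.
    Layers are natural numbers, so truncated subtraction loses none of them.\<close>
  define A1 where "A1 w = {fst w} \<times> layers {l (snd w) - 2..<l (snd w)}" for w :: "'a \<times> 'b"
  define A2 where "A2 w = B (fst w) \<times> layers {l (snd w) - 2..l (snd w) + 2}" for w
  define A3 where "A3 w = first ` (B (fst w) \<times> layers {l (snd w) - 1..l (snd w) + 1})" for w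
  define avoid where "avoid w = {w' \<in> A1 w \<union> A2 w \<union> A3 w. rank w' < rank w}" for w
  have finA: "finite (A1 w)" "finite (A2 w)" "finite (A3 w)" for w
    using finB fin_layers by (simp_all add: A1_def A2_def A3_def)
  have card_avoid: "card (avoid w) \<le> 8 * t + 2" if "w \<in> pverts G" for w
  proof -
    have t: "card (B (fst w)) \<le> t"
      using G_vert[of "fst w" "snd w"] that cardB by simp
    have "card (A1 w) \<le> 2"
      using card_layers[of "{l (snd w) - 2..<l (snd w)}"] by (simp add: A1_def card_cartesian_product)
    moreover have "card (A2 w) \<le> t * 5"
      unfolding A2_def card_cartesian_product
      using t by (intro mult_le_mono order_trans[OF card_layers]) auto
    moreover have "card (A3 w) \<le> t * 3"
    proof -
      have "card (A3 w) \<le> card (B (fst w) \<times> layers {l (snd w) - 1..l (snd w) + 1})"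
        unfolding A3_def using finB fin_layers by (intro card_image_le) simp
      also have "\<dots> \<le> t * 3"
        unfolding card_cartesian_product
        using t by (intro mult_le_mono order_trans[OF card_layers]) auto
      finally show ?thesis .
    qed
    moreover have "card (avoid w) \<le> card (A1 w \<union> A2 w \<union> A3 w)"
      using finA by (intro card_mono) (auto simp: avoid_def)
    moreover have "\<dots> \<le> card (A1 w) + card (A2 w) + card (A3 w)"
      by (meson add_le_mono card_Un_le order_refl order_trans)
    ultimately show ?thesis by linarith
  qed
  obtain \<phi> where \<phi>_le: "\<And>w. w \<in> pverts G \<Longrightarrow> \<phi> w \<le> 8 * t + 2"
    and \<phi>_avoid: "\<And>w u. w \<in> pverts G \<Longrightarrow> u \<in> avoid w \<Longrightarrow> \<phi> u \<noteq> \<phi> w"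
  proof (rule greedy_colouring[of "pverts G" avoid "8 * t + 2" rank])
    show "finite (avoid w)" for w
      using finA by (simp add: avoid_def)
  qed (use finG card_avoid in \<open>auto simp: avoid_def\<close>)

  \<comment> \<open>If \<open>x = y\<close>, the smaller rank forces \<open>l p < l q\<close>, which
    puts \<open>(x, p)\<close> into \<open>A1 (y, q)\<close>; otherwise it lies in
    \<open>A2 (y, q)\<close>.\<close>
  have near: "\<phi> (x, p) \<noteq> \<phi> (y, q)"
    if "(x, p) \<in> pverts G" "(y, q) \<in> pverts G" "rank (x, p) < rank (y, q)"
      "x = y \<or> x \<in> B y" "l p \<le> l q + 2" "l q \<le> l p + 2" for x p y q
  proof (rule \<phi>_avoid[OF that(2)])
    have "p \<in> pverts P" using that(1) G_vert by blast
    then have "(x, p) \<in> A1 (y, q) \<union> A2 (y, q)"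
      using that(3-6) by (auto simp: A1_def A2_def layers_def rank_def)
    with that(3) show "(x, p) \<in> avoid (y, q)" by (auto simp: avoid_def)
  qed

  have "proper_colouring G \<phi>"
    unfolding proper_colouring_def
  proof clarify
    fix x p y q
    assume arc: "((x, p), (y, q)) \<in> parcs G" and eq: "\<phi> (x, p) = \<phi> (y, q)"
    \<comment> \<open>Stated for arbitrary arcs, so that it applies to the given arc in whichever
      direction increases the rank.\<close>
    have less: False
      if "((x, p), (y, q)) \<in> parcs G" "\<phi> (x, p) = \<phi> (y, q)" "rank (x, p) < rank (y, q)"
      for x p y q
    proof -
      have "r x \<le> r y"
        using rank_le[of x p y q] that(3) G_arc[OF that(1)] G_vert by simp
      then have "x = y \<or> x \<in> B y"
        using G_prod[OF that(1)] B_cases[of x y] by (auto simp: B_iff)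
      then show False
        using near[of x p y q] G_arc[OF that(1)] G_prod[OF that(1)] that by auto
    qed
    have "rank (x, p) \<noteq> rank (y, q)"
      using rank_inj G_arc[OF arc] by (auto dest: inj_onD)
    then show False
      using less[OF arc eq] less[OF G_arc(4)[OF arc] eq[symmetric]] by linarith
  qed
  moreover have "odd_colouring G \<phi>"
  proof (rule odd_colouring_if_unique_colour)
    fix u assume "u \<in> pverts G" and ne: "neighbourhood G u \<noteq> {}"
    obtain x i where u: "u = (x, i)" by force
    obtain y0 j0 where w0: "first u = (y0, j0)" by force
    have first: "first u \<in> neighbourhood G u"
      and first_le: "\<And>w. w \<in> neighbourhood G u \<Longrightarrow> rank (first u) \<le> rank w"
      unfolding first_def using ne by (auto intro: arg_min_natI arg_min_nat_le)
    have arc0: "((x, i), (y0, j0)) \<in> parcs G"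
      using first unfolding w0 by (simp add: neighbourhood_def u)
    have "\<phi> w \<noteq> \<phi> (first u)" if w: "w \<in> neighbourhood G u" "w \<noteq> first u" for w
    proof -
      obtain y j where wy: "w = (y, j)" by force
      have arc: "((x, i), (y, j)) \<in> parcs G"
        using w by (simp add: neighbourhood_def u wy)
      have w_in: "(y, j) \<in> pverts G" "(y0, j0) \<in> pverts G" "(x, i) \<in> pverts G"
        using G_arc[OF arc] G_arc[OF arc0] by simp_all
      have "rank (y0, j0) \<noteq> rank (y, j)"
        using rank_inj w_in w by (auto simp: wy w0 dest: inj_onD)
      then have less: "rank (y0, j0) < rank (y, j)"
        using first_le[OF w(1)] by (simp add: wy w0)
      then have r_le: "r y0 \<le> r y"
        using rank_le[of y0 j0 y j] G_vert w_in by simp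
      show ?thesis
      proof (cases "x \<in> B y")
        case True
        have "(x, i) \<in> B y \<times> layers {l j - 1..l j + 1}"
          using True G_prod[OF arc] G_vert w_in by (auto simp: layers_def)
        then have "first u \<in> A3 (y, j)"
          unfolding A3_def u by (metis fst_conv image_eqI snd_conv)
        then have "first u \<in> avoid (y, j)"
          using less by (simp add: avoid_def w0)
        then show ?thesis
          using \<phi>_avoid[OF w_in(1)] wy by metis
      next
        case False
        have y: "y = x \<or> y \<in> B x"
          using False G_prod[OF arc] B_cases[of x y] by auto
        then have "r y \<le> r x" by (auto simp: B_iff)
        \<comment> \<open>The column of the first neighbour satisfies
          \<open>r y0 \<le> r y \<le> r x\<close>, so \<open>y0\<close> and \<open>y\<close> both
          lie in the clique formed by \<open>x\<close> and \<open>B x\<close>.\<close>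
        then have y0: "y0 = x \<or> y0 \<in> B x"
          using r_le G_prod[OF arc0] B_cases[of x y0] by (auto simp: B_iff)
        have "y0 = y \<or> y0 \<in> B y"
        proof (cases "y0 = y")
          case ne: False
          have "(y0, y) \<in> parcs H"
            using y y0 ne B_clique[of y0 x y] G_vert w_in H_arc(4)[of x y0]
            by (auto simp: B_iff)
          with r_le show ?thesis
            using B_cases[of y0 y] by (auto simp: B_iff)
        qed simp
        \<comment> \<open>Both neighbours are within one layer of \<open>u\<close>, hence within two
          layers of each other.\<close>
        then show ?thesis
          using near[OF w_in(2,1) less] G_prod[OF arc] G_prod[OF arc0] by (simp add: wy w0)
      qed
    qed
    with first show "\<exists>w\<in>neighbourhood G u. \<forall>w'\<in>neighbourhood G u. \<phi> w' = \<phi> w \<longrightarrow> w' = w"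
      by blast
  qed
  moreover have "num_colours G \<phi> \<le> 8 * t + 4"
  proof -
    \<comment> \<open>The colours 0 to \<open>8 * t + 2\<close> number \<open>8 * t + 3\<close>, one
      fewer than claimed.\<close>
    have "num_colours G \<phi> \<le> card {..8 * t + 2}"
      unfolding num_colours_def using \<phi>_le by (intro card_mono) auto
    then show ?thesis by simp
  qed
  ultimately show ?thesis by blast
qed

end
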